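(* Let $d\ge2$. The surface (boundary in $R_3\cong\mathbb R^3$) of $K(P_{A_3}^d)$ is a part of the tangent developable of an astroid in space. In the coordinates $(p_1,p_2,q)$ of $R_3$, the surface is given by $$\chi(u,v)=(4\cos^3u,\ 4\sin^3u,\ 6\cos2u)+v(\cos u,\ -\sin u,\ 2),\qquad -2-2\cos2u\le v\le 2-2\cos2u,\quad 0\le u<2\pi.$$
   Context: For $t_1,t_2,t_3\in\mathbb C\setminus\{0\}$ put $t_4=1/(t_1t_2t_3)$ and let $\Phi_1(t_1,t_2,t_3)=(z_1,z_2,z_3)$, where $z_j$ is the $j$-th elementary symmetric function of $t_1,t_2,t_3,t_4$. The polynomial map $P_{A_3}^d:\mathbb C^3\to\mathbb C^3$ is determined by $P_{A_3}^d(\Phi_1(t_1,t_2,t_3))=\Phi_1(t_1^d,t_2^d,t_3^d)$. $K(P_{A_3}^d)$ is the set of $z\in\mathbb C^3$ with bounded forward orbit under $P_{A_3}^d$; it is contained in the real three-dimensional subspace $R_3=\{(z_1,z_2,\bar z_1):z_1\in\mathbb C,z_2\in\mathbb R\}$, identified with $\mathbb R^3$ through the coordinates $(p_1,p_2,q)$ with $z_1=p_1+ip_2$, $z_2=q$. The astroid in space is the curve $u\mapsto(4\cos^3u,4\sin^3u,6\cos2u)$, $0\le u<2\pi$. A ruled surface is a tangent developable of a curve if its rulings are tangent lines to that base curve. *)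

theory Defs
  imports "HOL-Analysis.Analysis" "HOL-Computational_Algebra.Fundamental_Theorem_Algebra"
begin

definition Phi :: "complex \<Rightarrow> complex \<Rightarrow> complex \<Rightarrow> complex \<times> complex \<times> complex" where
  "Phi t1 t2 t3 = (let t4 = 1 / (t1 * t2 * t3) in
     (t1 + t2 + t3 + t4,
      t1 * t2 + t1 * t3 + t1 * t4 + t2 * t3 + t2 * t4 + t3 * t4,
      t1 * t2 * t3 + t1 * t2 * t4 + t1 * t3 * t4 + t2 * t3 * t4))"

(* Existence and uniqueness of P are proved as A3_map_exists1 below. *)
definition A3_map :: "nat \<Rightarrow> complex \<times> complex \<times> complex \<Rightarrow> complex \<times> complex \<times> complex" where
  "A3_map d = (THE P. \<forall>t1 t2 t3. t1 \<noteq> 0 \<longrightarrow> t2 \<noteq> 0 \<longrightarrow> t3 \<noteq> 0 \<longrightarrow>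
     P (Phi t1 t2 t3) = Phi (t1 ^ d) (t2 ^ d) (t3 ^ d))"

definition bounded_orbit_set :: "('a::metric_space \<Rightarrow> 'a) \<Rightarrow> 'a set" where
  "bounded_orbit_set f = {z. bounded (range (\<lambda>n. (f ^^ n) z))}"

definition R3 :: "(complex \<times> complex \<times> complex) set" where
  "R3 = {(z1, z2, cnj z1) | z1 z2. z2 \<in> \<real>}"

definition R3_coords :: "complex \<times> complex \<times> complex \<Rightarrow> real \<times> real \<times> real" where
  "R3_coords = (\<lambda>(z1, z2, z3). (Re z1, Im z1, Re z2))"

(* The boundary is taken relative to R3, and then read off in the coordinates of R3. *)
definition K_surface :: "nat \<Rightarrow> (real \<times> real \<times> real) set" where
  "K_surface d = R3_coords ` ((top_of_set R3) frontier_of (bounded_orbit_set (A3_map d)))"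

definition astroid :: "real \<Rightarrow> real \<times> real \<times> real" where
  "astroid u = (4 * cos u ^ 3, 4 * sin u ^ 3, 6 * cos (2 * u))"

definition ruled_surface ::
    "(real \<Rightarrow> 'a::real_vector) \<Rightarrow> (real \<Rightarrow> 'a) \<Rightarrow> real \<Rightarrow> real \<Rightarrow> 'a" where
  "ruled_surface \<gamma> \<delta> u v = \<gamma> u + v *\<^sub>R \<delta> u"

definition astroid_ruling :: "real \<Rightarrow> real \<times> real \<times> real" where
  "astroid_ruling u = (cos u, - sin u, 2)"

(* The tangent line is the limit of the secant lines: suitably rescaled secant vectors
   converge to w. Where the derivative of the curve is nonzero this says that w is a nonzero
   multiple of it, but it also covers the cusps of the astroid, where the derivative vanishes. *)
definition tangent_direction :: "(real \<Rightarrow> 'a::real_normed_vector) \<Rightarrow> real \<Rightarrow> 'a \<Rightarrow> bool" where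
  "tangent_direction \<gamma> u w \<longleftrightarrow>
     w \<noteq> 0 \<and> (\<exists>c. ((\<lambda>x. c x *\<^sub>R (\<gamma> x - \<gamma> u)) \<longlongrightarrow> w) (at u))"

definition tangent_line :: "(real \<Rightarrow> 'a::real_normed_vector) \<Rightarrow> real \<Rightarrow> 'a set \<Rightarrow> bool" where
  "tangent_line \<gamma> u L \<longleftrightarrow> (\<exists>w. tangent_direction \<gamma> u w \<and> L = range (\<lambda>s. \<gamma> u + s *\<^sub>R w))"

definition tangent_developable ::
    "(real \<Rightarrow> 'a::real_normed_vector) \<Rightarrow> (real \<Rightarrow> 'a) \<Rightarrow> real set \<Rightarrow> bool" where
  "tangent_developable \<gamma> \<delta> I \<longleftrightarrow> (\<forall>u\<in>I. tangent_line \<gamma> u (range (ruled_surface \<gamma> \<delta> u)))"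

lemma bij_betw_R3_coords: "bij_betw R3_coords R3 UNIV"
  unfolding bij_betw_def inj_on_def
proof safe
  fix p1 p2 q :: real
  have "(Complex p1 p2, complex_of_real q, cnj (Complex p1 p2)) \<in> R3"
    by (auto simp: R3_def)
  then show "(p1, p2, q) \<in> R3_coords ` R3"
    by (rule rev_image_eqI) (simp add: R3_coords_def)
qed (auto simp: R3_def R3_coords_def complex_eq_iff complex_is_Real_iff)

lemma prod4_eq:
  fixes a b c e :: complex
  shows "[:-a, 1:] * [:-b, 1:] * [:-c, 1:] * [:-e, 1:] =
    [:a*b*c*e, -(a*b*c + a*b*e + a*c*e + b*c*e), a*b + a*c + a*e + b*c + b*e + c*e, -(a+b+c+e), 1:]"
  by (simp add: algebra_simps)

lemma proots_prod4:
  fixes a b c e :: complex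
  shows "proots ([:-a, 1:] * [:-b, 1:] * [:-c, 1:] * [:-e, 1:]) = {#a, b, c, e#}"
proof -
  have "[:-x, 1:] \<noteq> 0" for x :: complex by simp
  then show ?thesis
    by (subst proots_mult, simp, simp)+ (simp add: add_mset_commute)
qed

lemma Phi_power_cong:
  assumes nz: "t1 \<noteq> 0" "t2 \<noteq> 0" "t3 \<noteq> 0" "s1 \<noteq> 0" "s2 \<noteq> 0" "s3 \<noteq> 0"
    and eq: "Phi t1 t2 t3 = Phi s1 s2 s3"
  shows "Phi (t1 ^ d) (t2 ^ d) (t3 ^ d) = Phi (s1 ^ d) (s2 ^ d) (s3 ^ d)"
proof -
  define t4 s4 where t4: "t4 = 1 / (t1 * t2 * t3)" and s4: "s4 = 1 / (s1 * s2 * s3)"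
  let ?Q = "\<lambda>a b c e. [:-a, 1:] * [:-b, 1:] * [:-c, 1:] * [:-e, 1::complex:]"
  have one: "t1 * t2 * t3 * t4 = 1" "s1 * s2 * s3 * s4 = 1"
    using nz by (simp_all add: t4 s4)
  have "?Q t1 t2 t3 t4 = ?Q s1 s2 s3 s4"
    using eq one unfolding prod4_eq Phi_def Let_def t4[symmetric] s4[symmetric]
    by (simp only: prod.inject)
  then have "{#t1, t2, t3, t4#} = {#s1, s2, s3, s4#}"
    by (metis proots_prod4)
  then have "image_mset (\<lambda>x. [:-(x ^ d), 1:]) {#t1, t2, t3, t4#} =
             image_mset (\<lambda>x. [:-(x ^ d), 1:]) {#s1, s2, s3, s4#}"
    by simp
  then have "prod_mset (image_mset (\<lambda>x. [:-(x ^ d), 1:]) {#t1, t2, t3, t4#}) =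
             prod_mset (image_mset (\<lambda>x. [:-(x ^ d), 1:]) {#s1, s2, s3, s4#})"
    by (rule arg_cong)
  then have "?Q (t1 ^ d) (t2 ^ d) (t3 ^ d) (t4 ^ d) = ?Q (s1 ^ d) (s2 ^ d) (s3 ^ d) (s4 ^ d)"
    by (simp only: image_mset_add_mset image_mset_empty prod_mset.add_mset prod_mset_empty
        mult.assoc mult_1_right)
  moreover have "t4 ^ d = 1 / (t1 ^ d * t2 ^ d * t3 ^ d)" "s4 ^ d = 1 / (s1 ^ d * s2 ^ d * s3 ^ d)"
    by (simp_all add: t4 s4 power_divide power_mult_distrib)
  ultimately show ?thesis
    unfolding prod4_eq Phi_def Let_def by (simp only: pCons_eq_iff neg_equal_iff_equal prod.inject)
qed

lemma Phi_surj:
  obtains t1 t2 t3 where "t1 \<noteq> 0" "t2 \<noteq> 0" "t3 \<noteq> 0" "z = Phi t1 t2 t3"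
proof -
  obtain z1 z2 z3 where z: "z = (z1, z2, z3)" by (cases z)
  define p where "p = [:1, -z3, z2, -z1, 1:]"
  have "size (proots p) = 4" by (simp add: size_proots_complex p_def)
  moreover obtain xs where xs: "mset xs = proots p" by (metis ex_mset)
  ultimately have "length xs = 4" by (metis size_mset)
  then obtain a b c e where "xs = [a, b, c, e]"
    by (auto simp: numeral_eq_Suc length_Suc_conv)
  then have r: "proots p = {#a, b, c, e#}" using xs by auto
  have "p = [:-a, 1:] * [:-b, 1:] * [:-c, 1:] * [:-e, 1:]"
    using complex_poly_decompose_multiset[of p] unfolding r
    by (simp only: image_mset_add_mset image_mset_empty prod_mset.add_mset prod_mset_empty
        mult.assoc mult_1_right) (simp add: p_def)
  then have *: "a * b * c * e = 1" "z3 = a*b*c + a*b*e + a*c*e + b*c*e"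
      "z2 = a*b + a*c + a*e + b*c + b*e + c*e" "z1 = a + b + c + e"
    unfolding prod4_eq p_def by (simp_all only: pCons_eq_iff neg_equal_iff_equal)
  then have nz: "a \<noteq> 0" "b \<noteq> 0" "c \<noteq> 0" by auto
  then have "e = 1 / (a * b * c)" using *(1) by (simp add: field_simps)
  then have "z = Phi a b c" unfolding Phi_def Let_def z * by simp
  then show ?thesis using nz that by blast
qed

lemma A3_map_exists1:
  "\<exists>!P. \<forall>t1 t2 t3. t1 \<noteq> 0 \<longrightarrow> t2 \<noteq> 0 \<longrightarrow> t3 \<noteq> 0 \<longrightarrow>
     P (Phi t1 t2 t3) = Phi (t1 ^ d) (t2 ^ d) (t3 ^ d)"
proof (rule ex_ex1I)
  have "\<forall>z. \<exists>w. \<forall>t1 t2 t3. t1 \<noteq> 0 \<longrightarrow> t2 \<noteq> 0 \<longrightarrow> t3 \<noteq> 0 \<longrightarrow> z = Phi t1 t2 t3 \<longrightarrow>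
      w = Phi (t1 ^ d) (t2 ^ d) (t3 ^ d)"
    by (metis Phi_power_cong)
  then show "\<exists>P. \<forall>t1 t2 t3. t1 \<noteq> 0 \<longrightarrow> t2 \<noteq> 0 \<longrightarrow> t3 \<noteq> 0 \<longrightarrow>
     P (Phi t1 t2 t3) = Phi (t1 ^ d) (t2 ^ d) (t3 ^ d)"
    by metis
next
  fix P Q
  assume "\<forall>t1 t2 t3. t1 \<noteq> 0 \<longrightarrow> t2 \<noteq> 0 \<longrightarrow> t3 \<noteq> 0 \<longrightarrow>
     P (Phi t1 t2 t3) = Phi (t1 ^ d) (t2 ^ d) (t3 ^ d)"
    and "\<forall>t1 t2 t3. t1 \<noteq> 0 \<longrightarrow> t2 \<noteq> 0 \<longrightarrow> t3 \<noteq> 0 \<longrightarrow>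
     Q (Phi t1 t2 t3) = Phi (t1 ^ d) (t2 ^ d) (t3 ^ d)"
  then show "P = Q" by (metis Phi_surj ext)
qed

lemma A3_map_Phi:
  "t1 \<noteq> 0 \<Longrightarrow> t2 \<noteq> 0 \<Longrightarrow> t3 \<noteq> 0 \<Longrightarrow>
   A3_map d (Phi t1 t2 t3) = Phi (t1 ^ d) (t2 ^ d) (t3 ^ d)"
  using theI'[OF A3_map_exists1[of d]] unfolding A3_map_def by blast

end

theory Submission
  imports Defs
begin

text \<open>
  A point \<open>(z1, z2, z3)\<close> is encoded by the quartic
  \<open>x ^ 4 - z1 * x ^ 3 + z2 * x ^ 2 - z3 * x + 1\<close>, and the map raises its roots to the
  power \<open>d\<close>. The coefficients of a monic polynomial bound its roots, and the roots of this one
  have product \<open>1\<close>; hence the orbit is bounded exactly when all four roots lie on the unit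
  circle, and the set \<open>K\<close> of these points is the compact image of a torus
  (\<open>bounded_orbit_set_A3_map\<close>).

  For points of \<open>R3\<close> the quartic is self-reciprocal: its roots are permuted by the reflection
  \<open>x \<mapsto> 1 / cnj x\<close> in the circle. If some root is off the circle, it and its reflection are two
  roots of the form \<open>r * t\<close> and \<open>t / r\<close> with \<open>norm t = 1\<close>, and the quartic is
  \<open>(x\<^sup>2 - \<rho> * t * x + t\<^sup>2) * (x\<^sup>2 - s * cnj t * x + (cnj t)\<^sup>2)\<close> with \<open>s\<close> real and
  \<open>\<rho> = r + 1 / r\<close>, which is at least \<open>2\<close>. Let \<open>W\<close> be the set of all points given by such
  products with \<open>\<rho> \<ge> 2\<close>. Then \<open>R3\<close> is covered by \<open>K\<close> and \<open>W\<close>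
  (\<open>R3_subset\<close>), and \<open>W\<close> is closed because its parametrization is proper
  (\<open>closed_reflected_pair_set\<close>). Both sets being closed, the boundary of \<open>K\<close> in \<open>R3\<close> is
  contained in their intersection. A product of quadratics as above lies in \<open>K\<close> exactly when
  \<open>\<bar>\<rho>\<bar> \<le> 2\<close> and \<open>\<bar>s\<bar> \<le> 2\<close>, so the intersection is given by \<open>\<rho> = 2\<close>,
  \<open>\<bar>s\<bar> \<le> 2\<close>, where \<open>t\<close> is a double root. Raising \<open>\<rho>\<close> slightly above \<open>2\<close> splits this
  double root off the circle, so that all of these points are boundary points
  (\<open>frontier_bounded_orbit_set\<close>). With \<open>t = cis u\<close> and \<open>v = s - 2 * cos (2 * u)\<close> they
  form the ruled surface, and \<open>\<bar>s\<bar> \<le> 2\<close> is the stated range of \<open>v\<close>.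

  The rulings are tangent lines because the derivative of the astroid is
  \<open>- 12 * sin u * cos u\<close> times the ruling direction. At the cusps this factor vanishes, so the
  tangent lines are found from secants rescaled so as to have last coordinate \<open>2\<close>.
\<close>

section \<open>The curve and its tangent lines\<close>

text \<open>
  For \<open>b \<noteq> 0\<close> this is the derivative \<open>3 * b\<^sup>2\<close> of the cube divided by the derivative
  \<open>2 * b\<close> of the square; for \<open>b = 0\<close> the quotient is \<open>f x\<close> itself. Since \<open>b = 0\<close> is
  covered, the cusps of the astroid are treated together with its regular points.
\<close>

lemma tendsto_cube_quotient:
  fixes f :: "'a \<Rightarrow> real"
  assumes "(f \<longlongrightarrow> b) F" and "eventually (\<lambda>x. f x ^ 2 \<noteq> b ^ 2) F"
  shows "((\<lambda>x. (f x ^ 3 - b ^ 3) / (f x ^ 2 - b ^ 2)) \<longlongrightarrow> 3 / 2 * b) F"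
proof (cases "b = 0")
  case True
  have "eventually (\<lambda>x. f x = (f x ^ 3 - b ^ 3) / (f x ^ 2 - b ^ 2)) F"
    using assms(2) by eventually_elim (simp add: True power2_eq_square power3_eq_cube)
  then show ?thesis
    using tendsto_cong[THEN iffD1, OF _ assms(1)] True by simp
next
  case False
  have lim: "((\<lambda>x. (f x ^ 2 + f x * b + b ^ 2) / (f x + b)) \<longlongrightarrow> (b ^ 2 + b * b + b ^ 2) / (b + b)) F"
    using False by (intro tendsto_intros assms(1)) auto
  have val: "(b ^ 2 + b * b + b ^ 2) / (b + b) = 3 / 2 * b"
    using False by (simp add: field_simps power2_eq_square)
  have ev: "eventually (\<lambda>x. (f x ^ 2 + f x * b + b ^ 2) / (f x + b) =
      (f x ^ 3 - b ^ 3) / (f x ^ 2 - b ^ 2)) F"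
    using assms(2)
  proof eventually_elim
    case (elim x)
    then have "f x - b \<noteq> 0" "f x + b \<noteq> 0" "f x ^ 2 - b ^ 2 \<noteq> 0"
      by (auto simp: power2_eq_square add_eq_0_iff2)
    then show ?case
      by (simp add: frac_eq_eq) (simp add: algebra_simps power2_eq_square power3_eq_cube)
  qed
  show ?thesis
    using lim unfolding tendsto_cong[OF ev] val .
qed

text \<open>
  The difference of the squares is \<open>- sin (x + u) * sin (x - u)\<close>, and each factor has isolated
  zeros.
\<close>

lemma eventually_cos_sq_neq:
  "eventually (\<lambda>x. cos x ^ 2 \<noteq> cos u ^ 2) (at (u::real))"
proof -
  have small: "eventually (\<lambda>x. sin (x - u) \<noteq> 0) (at u)"
    unfolding eventually_at
  proof (intro exI[of _ pi] conjI ballI impI)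
    fix x assume "x \<noteq> u \<and> dist x u < pi"
    then have "x - u \<noteq> 0" "\<bar>x - u\<bar> < pi" by (auto simp: dist_real_def)
    then show "sin (x - u) \<noteq> 0"
      using sin_gt_zero[of "x - u"] sin_gt_zero[of "u - x"] sin_minus[of "x - u"]
      by (cases "x - u > 0") auto
  qed simp
  have "eventually (\<lambda>x. sin (x + u) \<noteq> 0) (at u)"
  proof (cases "sin (u + u) = 0")
    case True
    then have "cos (u + u) \<noteq> 0"
      using sin_cos_squared_add[of "u + u"] by auto
    moreover have "sin (x + u) = cos (u + u) * sin (x - u)" for x
      using True sin_add[of "u + u" "x - u"] by (simp add: algebra_simps)
    ultimately show ?thesis using small by simp
  next
    case False
    have "((\<lambda>x. sin (x + u)) \<longlongrightarrow> sin (u + u)) (at u)"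
      by (intro tendsto_intros)
    then show ?thesis using False by (rule tendsto_imp_eventually_ne)
  qed
  with small show ?thesis
  proof eventually_elim
    case (elim x)
    have "sin (x + u) * sin (x - u) = (sin x * cos u)\<^sup>2 - (cos x * sin u)\<^sup>2"
      by (simp add: sin_add sin_diff power2_eq_square algebra_simps)
    also have "\<dots> = cos u ^ 2 - cos x ^ 2"
      by (simp add: power_mult_distrib sin_squared_eq algebra_simps)
    finally show ?case using elim by auto
  qed
qed

lemma astroid_tangent_direction:
  "tangent_direction astroid u (astroid_ruling u)"
proof -
  \<comment> \<open>The last coordinate of the secant vector is \<open>12 * (cos x ^ 2 - cos u ^ 2)\<close>, and that of
    the ruling is \<open>2\<close>; this determines the scaling factor.\<close>
  let ?c = "\<lambda>x. 1 / (6 * (cos x ^ 2 - cos u ^ 2))"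
  note ev = eventually_cos_sq_neq[of u]
  have sin_ev: "eventually (\<lambda>x. sin x ^ 2 \<noteq> sin u ^ 2) (at u)"
    using ev by eventually_elim (simp add: sin_squared_eq)
  have lim: "((\<lambda>x. (2 / 3 * ((cos x ^ 3 - cos u ^ 3) / (cos x ^ 2 - cos u ^ 2)),
        - (2 / 3) * ((sin x ^ 3 - sin u ^ 3) / (sin x ^ 2 - sin u ^ 2)), 2 :: real))
      \<longlongrightarrow> (2 / 3 * (3 / 2 * cos u), - (2 / 3) * (3 / 2 * sin u), 2 :: real)) (at u)"
    by (intro tendsto_Pair tendsto_mult tendsto_const tendsto_cube_quotient ev sin_ev)
       (intro tendsto_intros)+
  have "eventually (\<lambda>x. (2 / 3 * ((cos x ^ 3 - cos u ^ 3) / (cos x ^ 2 - cos u ^ 2)),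
        - (2 / 3) * ((sin x ^ 3 - sin u ^ 3) / (sin x ^ 2 - sin u ^ 2)), 2 :: real)
      = ?c x *\<^sub>R (astroid x - astroid u)) (at u)"
    using ev
  proof eventually_elim
    case (elim x)
    then have nz: "cos x ^ 2 - cos u ^ 2 \<noteq> 0" by simp
    have sin: "sin x ^ 2 - sin u ^ 2 = - (cos x ^ 2 - cos u ^ 2)"
      by (simp add: sin_squared_eq)
    have "6 * cos (2 * x) - 6 * cos (2 * u) = 12 * (cos x ^ 2 - cos u ^ 2)"
      by (simp add: cos_double_cos)
    with nz show ?case
      unfolding astroid_def sin by (simp add: field_simps)
  qed
  with lim have "((\<lambda>x. ?c x *\<^sub>R (astroid x - astroid u)) \<longlongrightarrow> astroid_ruling u) (at u)"
    unfolding astroid_ruling_def using tendsto_cong[THEN iffD1] by simp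
  then show ?thesis
    unfolding tangent_direction_def by (auto simp: astroid_ruling_def zero_prod_def)
qed

lemma tangent_developable_astroid: "tangent_developable astroid astroid_ruling I"
  unfolding tangent_developable_def tangent_line_def ruled_surface_def
  using astroid_tangent_direction by blast

section \<open>Points of bounded orbit\<close>

lemma Phi_root_iff:
  assumes "a \<noteq> 0" "b \<noteq> 0" "c \<noteq> 0" "Phi a b c = (z1, z2, z3)"
  shows "x ^ 4 - z1 * x ^ 3 + z2 * x ^ 2 - z3 * x + 1 = 0 \<longleftrightarrow>
    x \<in> {a, b, c, 1 / (a * b * c)}"
proof -
  define e where "e = 1 / (a * b * c)"
  have one: "a * b * c * e = 1" using assms by (simp add: e_def)
  have z: "z1 = a + b + c + e" "z2 = a * b + a * c + a * e + b * c + b * e + c * e"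
    "z3 = a * b * c + a * b * e + a * c * e + b * c * e"
    using assms(4) unfolding Phi_def Let_def e_def[symmetric] by auto
  have "x ^ 4 - z1 * x ^ 3 + z2 * x ^ 2 - z3 * x + 1 =
      x ^ 4 - z1 * x ^ 3 + z2 * x ^ 2 - z3 * x + a * b * c * e"
    by (simp add: one)
  also have "\<dots> = (x - a) * (x - b) * (x - c) * (x - e)"
    unfolding z by algebra
  finally show ?thesis
    unfolding e_def[symmetric] by auto
qed

text \<open>
  Outside the unit disc the leading term can only be balanced by the others if
  \<open>norm x\<close> is at most the sum of the norms of the coefficients.
\<close>

lemma norm_quartic_root_le:
  fixes x z1 z2 z3 :: complex
  assumes root: "x ^ 4 - z1 * x ^ 3 + z2 * x ^ 2 - z3 * x + 1 = 0"
    and le: "norm (z1, z2, z3) \<le> B"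
  shows "norm x \<le> 3 * B + 1"
proof (cases "norm x \<le> 1")
  case True
  have "0 \<le> B" using le norm_ge_zero order_trans by blast
  with True show ?thesis by linarith
next
  case False
  let ?r = "norm x"
  have r: "?r \<ge> 1" using False by simp
  have z: "norm z1 \<le> B" "norm z2 \<le> B" "norm z3 \<le> B"
    using norm_fst_le[of z1 "(z2, z3)"] norm_snd_le[of "(z2, z3)" z1]
      norm_fst_le[of z2 z3] norm_snd_le[of z3 z2] le by auto
  have B: "0 \<le> B" using z(1) norm_ge_zero order_trans by blast
  have pw: "?r ^ 2 \<le> ?r ^ 3" "?r \<le> ?r ^ 3" "1 \<le> ?r ^ 3"
    using r power_increasing[of 2 3 ?r] power_increasing[of 1 3 ?r] power_increasing[of 0 3 ?r]
    by auto
  have "x ^ 4 = z1 * x ^ 3 - z2 * x ^ 2 + z3 * x - 1" using root by algebra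
  then have "?r ^ 4 = norm (z1 * x ^ 3 - z2 * x ^ 2 + z3 * x - 1)"
    by (metis norm_power)
  also have "\<dots> \<le> norm z1 * ?r ^ 3 + norm z2 * ?r ^ 2 + norm z3 * ?r + 1"
    by (intro order_trans[OF norm_triangle_ineq4] order_trans[OF norm_triangle_ineq] add_mono)
       (auto simp: norm_mult norm_power)
  also have "\<dots> \<le> B * ?r ^ 3 + B * ?r ^ 3 + B * ?r ^ 3 + ?r ^ 3"
    using z pw B r by (intro add_mono mult_mono) auto
  also have "\<dots> = (3 * B + 1) * ?r ^ 3" by (simp add: algebra_simps)
  finally have "?r * ?r ^ 3 \<le> (3 * B + 1) * ?r ^ 3"
    by (simp add: power_Suc[symmetric] eval_nat_numeral)
  moreover have "0 < ?r ^ 3" using pw(3) by linarith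
  ultimately show ?thesis by simp
qed

lemma A3_map_funpow_Phi:
  assumes "a \<noteq> 0" "b \<noteq> 0" "c \<noteq> 0"
  shows "(A3_map d ^^ n) (Phi a b c) = Phi (a ^ (d ^ n)) (b ^ (d ^ n)) (c ^ (d ^ n))"
proof (induction n)
  case (Suc n)
  then show ?case
    using assms by (simp add: A3_map_Phi power_mult[symmetric] mult.commute)
qed simp

lemma compact_Phi_torus:
  "compact ((\<lambda>(a, b, c). Phi a b c) ` (sphere 0 1 \<times> sphere 0 1 \<times> sphere 0 1))"
proof (rule compact_continuous_image)
  show "continuous_on (sphere 0 1 \<times> sphere 0 1 \<times> sphere 0 1) (\<lambda>(a, b, c). Phi a b c)"
    unfolding Phi_def Let_def case_prod_unfold
    by (intro continuous_intros) auto
qed (intro compact_Times compact_sphere)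

lemma norm_le_one_if_powers_bounded:
  fixes x :: "'a::real_normed_div_algebra"
  assumes "d \<ge> 2" and "\<And>n. norm (x ^ (d ^ n)) \<le> C"
  shows "norm x \<le> 1"
proof (rule ccontr)
  assume "\<not> norm x \<le> 1"
  then have gt: "norm x > 1" by simp
  then obtain n where n: "C < norm x ^ n" using real_arch_pow by blast
  have "n \<le> d ^ n"
    using assms(1) by (meson less_exp less_imp_le order_trans power_mono zero_le)
  then have "norm x ^ n \<le> norm x ^ (d ^ n)" using gt by (intro power_increasing) auto
  with n assms(2)[of n] show False by (simp add: norm_power)
qed

text \<open>
  A bounded orbit bounds the roots \<open>x ^ (d ^ n)\<close> uniformly in \<open>n\<close>, so none of the four initial
  roots lies outside the closed disc; as their product is \<open>1\<close>, none lies inside the open disc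
  either.
\<close>

lemma Phi_mem_bounded_orbit_set_iff:
  assumes "d \<ge> 2" and nz: "a \<noteq> 0" "b \<noteq> 0" "c \<noteq> 0"
  shows "Phi a b c \<in> bounded_orbit_set (A3_map d) \<longleftrightarrow> norm a = 1 \<and> norm b = 1 \<and> norm c = 1"
proof
  assume "norm a = 1 \<and> norm b = 1 \<and> norm c = 1"
  then have "range (\<lambda>n. (A3_map d ^^ n) (Phi a b c)) \<subseteq>
      (\<lambda>(a, b, c). Phi a b c) ` (sphere 0 1 \<times> sphere 0 1 \<times> sphere 0 1)"
    by (auto simp: A3_map_funpow_Phi[OF nz] norm_power case_prod_unfold
        intro!: rev_image_eqI[of "(a ^ (d ^ n), b ^ (d ^ n), c ^ (d ^ n))" for n])
  then show "Phi a b c \<in> bounded_orbit_set (A3_map d)"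
    unfolding bounded_orbit_set_def
    using bounded_subset[OF compact_imp_bounded[OF compact_Phi_torus]] by blast
next
  assume "Phi a b c \<in> bounded_orbit_set (A3_map d)"
  then obtain B where B: "\<And>n. norm (Phi (a ^ (d ^ n)) (b ^ (d ^ n)) (c ^ (d ^ n))) \<le> B"
    unfolding bounded_orbit_set_def bounded_iff mem_Collect_eq A3_map_funpow_Phi[OF nz] by blast
  define e where "e = 1 / (a * b * c)"
  have le: "norm x \<le> 1" if x: "x \<in> {a, b, c, e}" for x
  proof (rule norm_le_one_if_powers_bounded[OF assms(1), of x "3 * B + 1"])
    fix n
    obtain z1 z2 z3 where z: "Phi (a ^ (d ^ n)) (b ^ (d ^ n)) (c ^ (d ^ n)) = (z1, z2, z3)"
      by (metis prod.exhaust)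
    have "x ^ (d ^ n) \<in>
        {a ^ (d ^ n), b ^ (d ^ n), c ^ (d ^ n), 1 / (a ^ (d ^ n) * b ^ (d ^ n) * c ^ (d ^ n))}"
      using x by (auto simp: e_def power_divide power_mult_distrib)
    then have "(x ^ (d ^ n)) ^ 4 - z1 * (x ^ (d ^ n)) ^ 3 + z2 * (x ^ (d ^ n)) ^ 2
        - z3 * x ^ (d ^ n) + 1 = 0"
      using Phi_root_iff[OF _ _ _ z] nz by simp
    then show "norm (x ^ (d ^ n)) \<le> 3 * B + 1"
      using B[of n] unfolding z by (rule norm_quartic_root_le)
  qed
  have prod: "norm a * norm b * norm c * norm e = 1"
    using nz by (simp add: e_def norm_divide norm_mult)
  have one: "w = 1 \<and> x = 1 \<and> y = 1"
    if "w * x * y * v = 1" "w \<le> 1" "x \<le> 1" "y \<le> 1" "v \<le> 1"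
      "0 \<le> w" "0 \<le> x" "0 \<le> y" "0 \<le> v" for w x y v :: real
  proof -
    have "w * (x * y * v) \<le> w" "x * (w * y * v) \<le> x" "y * (w * x * v) \<le> y"
      using that(2-) by (intro mult_left_le mult_le_one mult_nonneg_nonneg; simp)+
    then show ?thesis using that by (simp add: mult_ac)
  qed
  show "norm a = 1 \<and> norm b = 1 \<and> norm c = 1"
    by (rule one[OF prod]) (use le in auto)
qed

lemma bounded_orbit_set_A3_map:
  assumes "d \<ge> 2"
  shows "bounded_orbit_set (A3_map d) =
    (\<lambda>(a, b, c). Phi a b c) ` (sphere 0 1 \<times> sphere 0 1 \<times> sphere 0 1)"
proof (intro equalityI subsetI)
  fix z assume z: "z \<in> bounded_orbit_set (A3_map d)"
  obtain a b c where abc: "a \<noteq> 0" "b \<noteq> 0" "c \<noteq> 0" "z = Phi a b c" by (rule Phi_surj)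
  then show "z \<in> (\<lambda>(a, b, c). Phi a b c) ` (sphere 0 1 \<times> sphere 0 1 \<times> sphere 0 1)"
    using z Phi_mem_bounded_orbit_set_iff[OF assms abc(1-3)] by force
next
  fix z assume "z \<in> (\<lambda>(a, b, c). Phi a b c) ` (sphere 0 1 \<times> sphere 0 1 \<times> sphere 0 1)"
  then obtain a b c where abc: "norm a = 1" "norm b = 1" "norm c = 1" "z = Phi a b c" by auto
  then have "a \<noteq> 0" "b \<noteq> 0" "c \<noteq> 0" by auto
  then show "z \<in> bounded_orbit_set (A3_map d)"
    using Phi_mem_bounded_orbit_set_iff[OF assms] abc by simp
qed

section \<open>Self-reciprocal quartics as products of two quadratics\<close>

text \<open>
  The point whose quartic is
  \<open>(x\<^sup>2 - \<rho> * t * x + t\<^sup>2) * (x\<^sup>2 - s * cnj t * x + (cnj t)\<^sup>2)\<close>, when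
  \<open>norm t = 1\<close>. In the middle coordinate \<open>2 * Re (t\<^sup>2)\<close> is \<open>t\<^sup>2 + (cnj t)\<^sup>2\<close>, and the
  third coordinate is the sum of the triple products of the roots, which equals the conjugate of
  their sum.
\<close>

definition quadratics_point :: "real \<Rightarrow> real \<Rightarrow> complex \<Rightarrow> complex \<times> complex \<times> complex" where
  "quadratics_point \<rho> s t = (of_real \<rho> * t + of_real s * cnj t, of_real (2 * Re (t\<^sup>2) + \<rho> * s),
     cnj (of_real \<rho> * t + of_real s * cnj t))"

lemma quadratics_point_in_R3: "quadratics_point \<rho> s t \<in> R3"
  by (auto simp: quadratics_point_def R3_def)

text \<open>
  The first quadratic has the roots \<open>t * w\<close> and \<open>t / w\<close>, the second one \<open>cnj t * v\<close> and
  \<open>cnj t / v\<close>.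
\<close>

lemma quadratics_point_eq_Phi:
  assumes t: "norm t = 1" and nz: "w \<noteq> 0" "v \<noteq> 0"
    and w: "w + 1 / w = of_real \<rho>" and v: "v + 1 / v = of_real s"
  shows "quadratics_point \<rho> s t = Phi (t * w) (t / w) (cnj t * v)"
proof -
  have tt: "t * cnj t = 1" using t by (simp add: complex_norm_square[symmetric])
  have t0: "t \<noteq> 0" using t by auto
  define w' v' where "w' = 1 / w" and "v' = 1 / v"
  have ww: "w * w' = 1" and vv: "v * v' = 1" using nz by (simp_all add: w'_def v'_def)
  have "1 / (t * w * (t / w) * (cnj t * v)) = cnj t * v'"
  proof -
    have "t * w * (t / w) * (cnj t * v) = t * (t * cnj t) * v" using nz by simp
    then have "1 / (t * w * (t / w) * (cnj t * v)) = 1 / (t * v)" by (simp add: tt)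
    also have "\<dots> = (t * cnj t) / (t * v)" by (simp add: tt)
    also have "\<dots> = cnj t * v'" using t0 by (simp add: v'_def)
    finally show ?thesis .
  qed
  moreover have "t / w = t * w'" by (simp add: w'_def)
  moreover have "complex_of_real (2 * Re (t\<^sup>2)) = t\<^sup>2 + (cnj t)\<^sup>2"
    by (metis complex_add_cnj complex_cnj_power)
  moreover have "of_real \<rho> * t + of_real s * cnj t = t * w + t * w' + cnj t * v + cnj t * v'"
    unfolding w[symmetric] v[symmetric] w'_def v'_def by (simp add: algebra_simps)
  moreover have "t\<^sup>2 + (cnj t)\<^sup>2 + of_real \<rho> * of_real s =
      t * w * (t * w') + t * w * (cnj t * v) + t * w * (cnj t * v') +
      t * w' * (cnj t * v) + t * w' * (cnj t * v') + cnj t * v * (cnj t * v')"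
    using ww vv tt unfolding w[symmetric] v[symmetric] w'_def[symmetric] v'_def[symmetric]
    by algebra
  moreover have "of_real \<rho> * cnj t + of_real s * t =
      t * w * (t * w') * (cnj t * v) + t * w * (t * w') * (cnj t * v') +
      t * w * (cnj t * v) * (cnj t * v') + t * w' * (cnj t * v) * (cnj t * v')"
    using ww vv tt unfolding w[symmetric] v[symmetric] w'_def[symmetric] v'_def[symmetric]
    by algebra
  ultimately show ?thesis
    unfolding quadratics_point_def Phi_def Let_def of_real_add[of "2 * Re (t\<^sup>2)"]
      complex_cnj_add complex_cnj_mult complex_cnj_complex_of_real complex_cnj_cnj
      of_real_mult[of \<rho>]
    by (simp only:)
qed

lemma ex_sum_inverse_eq:
  fixes z :: complex
  obtains w where "w \<noteq> 0" "w + 1 / w = z"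
proof -
  define w where "w = (z + csqrt (z\<^sup>2 - 4)) / 2"
  have "2 * w - z = csqrt (z\<^sup>2 - 4)" by (simp add: w_def del: distrib_left_numeral)
  then have "(2 * w - z)\<^sup>2 = z\<^sup>2 - 4" by simp
  then have "4 * (w * w + 1) = 4 * (z * w)" by algebra
  then have *: "w * w + 1 = z * w" by (simp del: distrib_left_numeral)
  then have "w \<noteq> 0" by auto
  moreover have "w + 1 / w = z" using * \<open>w \<noteq> 0\<close> by (simp add: field_simps)
  ultimately show ?thesis using that by blast
qed

text \<open>
  The two solutions of \<open>w + 1 / w = \<rho>\<close> are \<open>cis \<theta>\<close> and its conjugate if
  \<open>\<rho> = 2 * cos \<theta>\<close>.
\<close>

lemma norm_eq_1_iff_sum_inverse_le:
  assumes "w \<noteq> 0" "w + 1 / w = complex_of_real \<rho>"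
  shows "norm w = 1 \<longleftrightarrow> \<bar>\<rho>\<bar> \<le> 2"
proof
  assume "norm w = 1"
  then have "norm (w + 1 / w) \<le> 1 + 1"
    by (metis norm_divide norm_one norm_triangle_mono order_refl div_by_1)
  then show "\<bar>\<rho>\<bar> \<le> 2" using assms by simp
next
  assume \<rho>: "\<bar>\<rho>\<bar> \<le> 2"
  define \<theta> where "\<theta> = arccos (\<rho> / 2)"
  have "2 * cos \<theta> = \<rho>" using \<rho> by (simp add: \<theta>_def cos_arccos_abs)
  then have s: "complex_of_real \<rho> = cis \<theta> + cnj (cis \<theta>)" by (simp add: complex_eq_iff)
  have p: "cis \<theta> * cnj (cis \<theta>) = 1" by (simp add: complex_norm_square[symmetric])
  have "w * w - of_real \<rho> * w + 1 = 0" using assms by (simp add: field_simps)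
  then have "(w - cis \<theta>) * (w - cnj (cis \<theta>)) = 0"
    unfolding s using p by algebra
  then show "norm w = 1" by (auto simp del: cis_cnj)
qed

lemma quadratics_point_mem_bounded_orbit_set_iff:
  assumes "d \<ge> 2" "norm t = 1"
  shows "quadratics_point \<rho> s t \<in> bounded_orbit_set (A3_map d) \<longleftrightarrow> \<bar>\<rho>\<bar> \<le> 2 \<and> \<bar>s\<bar> \<le> 2"
proof -
  obtain w where w: "w \<noteq> 0" "w + 1 / w = complex_of_real \<rho>" by (rule ex_sum_inverse_eq)
  obtain v where v: "v \<noteq> 0" "v + 1 / v = complex_of_real s" by (rule ex_sum_inverse_eq)
  have t0: "t \<noteq> 0" using assms by auto
  have "quadratics_point \<rho> s t \<in> bounded_orbit_set (A3_map d) \<longleftrightarrow>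
      norm (t * w) = 1 \<and> norm (t / w) = 1 \<and> norm (cnj t * v) = 1"
    unfolding quadratics_point_eq_Phi[OF assms(2) w(1) v(1) w(2) v(2)]
    using Phi_mem_bounded_orbit_set_iff[OF assms(1)] t0 w v by simp
  also have "\<dots> \<longleftrightarrow> norm w = 1 \<and> norm v = 1"
    using assms(2) by (auto simp: norm_mult norm_divide)
  finally show ?thesis
    using norm_eq_1_iff_sum_inverse_le w v by simp
qed

text \<open>
  The points whose quartic has two roots that are reflections of each other in the unit circle;
  for \<open>\<rho> = 2\<close> these coincide and form a double root on the circle. Including this limiting case
  makes the set closed.
\<close>

definition reflected_pair_set :: "(complex \<times> complex \<times> complex) set" where
  "reflected_pair_set = {quadratics_point \<rho> s t | \<rho> s t. 2 \<le> \<rho> \<and> norm t = 1}"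

text \<open>
  The reflection \<open>y\<close> of \<open>x\<close> is a second root, with \<open>x + y = \<rho> * t\<close> and
  \<open>x * y = t\<^sup>2\<close> for \<open>t = sgn x\<close>. Hence the quartic is divisible by
  \<open>x\<^sup>2 - \<rho> * t * x + t\<^sup>2\<close>, and comparing the quadratic coefficient, which is real, shows that
  the complementary parameter \<open>s\<close> is real.
\<close>

lemma off_circle_root_imp_reflected_pair:
  assumes "z2 \<in> \<real>" and x0: "x \<noteq> 0" and x1: "norm x \<noteq> 1"
    and root: "x ^ 4 - z1 * x ^ 3 + z2 * x ^ 2 - cnj z1 * x + 1 = 0"
  shows "(z1, z2, cnj z1) \<in> reflected_pair_set"
proof -
  define y t \<rho> where "y = 1 / cnj x" and "t = sgn x" and "\<rho> = norm x + 1 / norm x"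
  have y0: "y \<noteq> 0" using x0 by (simp add: y_def)
  have tn: "norm t = 1" using x0 by (simp add: t_def norm_sgn)
  have tt: "t * cnj t = 1" using tn by (simp add: complex_norm_square[symmetric])
  have xt: "x = of_real (norm x) * t" using x0 by (simp add: t_def sgn_eq)
  have yt: "y = of_real (1 / norm x) * t"
  proof -
    have "cnj x * (of_real (1 / norm x) * t) = t * cnj t"
      using x0 by (subst xt) simp
    then show ?thesis using x0 tt by (simp add: y_def field_simps)
  qed
  have sum: "x + y = of_real \<rho> * t"
    by (subst xt, subst yt) (simp add: \<rho>_def algebra_simps)
  have prod: "x * y = t\<^sup>2"
    using x0 by (subst xt, subst yt) (simp add: power2_eq_square)
  have xy: "x \<noteq> y"
  proof
    assume "x = y"
    then have "x * cnj x = 1" unfolding y_def using x0 by (metis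
        complex_cnj_zero_iff nonzero_eq_divide_eq)
    then have "complex_of_real ((norm x)\<^sup>2) = 1" by (metis complex_norm_square)
    then have "(norm x)\<^sup>2 = 1" by (metis of_real_eq_1_iff)
    then have "norm x = 1" by (metis norm_ge_zero one_power2 power2_eq_imp_eq zero_le_one)
    with x1 show False by simp
  qed
  have root_y: "y ^ 4 - z1 * y ^ 3 + z2 * y ^ 2 - cnj z1 * y + 1 = 0"
  proof -
    have yx: "y * cnj x = 1" using x0 by (simp add: y_def)
    have "cnj (x ^ 4 - z1 * x ^ 3 + z2 * x ^ 2 - cnj z1 * x + 1) = 0"
      by (simp only: root complex_cnj_zero)
    then have "cnj x ^ 4 - cnj z1 * cnj x ^ 3 + z2 * cnj x ^ 2 - z1 * cnj x + 1 = 0"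
      using assms(1) by (simp add: Reals_cnj_iff)
    with yx show ?thesis by algebra
  qed
  \<comment> \<open>\<open>\<sigma>\<close> is the sum of the other two roots. The defects \<open>\<delta>2\<close> and \<open>\<delta>3\<close> are the
    coefficients of the remainder left by the factorization into quadratics; two distinct roots
    force them to vanish.\<close>
  define \<sigma> where "\<sigma> = z1 - (x + y)"
  define s where "s = \<sigma> * t"
  define \<delta>2 \<delta>3 where "\<delta>2 = z2 - (x * y + (cnj t)\<^sup>2 + (x + y) * \<sigma>)"
    and "\<delta>3 = cnj z1 - (x * y * \<sigma> + (cnj t)\<^sup>2 * (x + y))"
  have pp: "x * y * (cnj t)\<^sup>2 = 1"
    unfolding prod using tt by (metis power_mult_distrib one_power2)
  have "x * (\<delta>2 * x - \<delta>3) = 0" "y * (\<delta>2 * y - \<delta>3) = 0"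
    using root root_y pp unfolding \<delta>2_def \<delta>3_def \<sigma>_def by algebra+
  then have "\<delta>2 * x - \<delta>3 = 0" "\<delta>2 * y - \<delta>3 = 0" using x0 y0 by auto
  then have "\<delta>2 * (x - y) = 0" by algebra
  then have "\<delta>2 = 0" using xy by simp
  have \<sigma>: "\<sigma> = s * cnj t" using tt unfolding s_def by algebra
  have "(x + y) * \<sigma> = of_real \<rho> * s" unfolding sum s_def by simp
  then have z2: "z2 = t\<^sup>2 + (cnj t)\<^sup>2 + of_real \<rho> * s"
    using \<open>\<delta>2 = 0\<close> unfolding \<delta>2_def prod by simp
  have re: "t\<^sup>2 + (cnj t)\<^sup>2 = complex_of_real (2 * Re (t\<^sup>2))"
    by (metis complex_add_cnj complex_cnj_power)
  have \<rho>2: "\<rho> \<ge> 2"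
  proof -
    have "(norm x - 1)\<^sup>2 \<ge> 0" by simp
    then have "norm x * norm x + 1 \<ge> 2 * norm x" by (simp add: power2_eq_square algebra_simps)
    then show ?thesis using x0 by (simp add: \<rho>_def field_simps)
  qed
  have "of_real \<rho> * s \<in> \<real>"
    using z2 re assms(1) by (metis Reals_diff Reals_of_real add_diff_cancel_left')
  then have "s \<in> \<real>"
    using \<rho>2 by (metis Reals_divide Reals_of_real mult.commute nonzero_mult_div_cancel_right
        not_numeral_le_zero of_real_eq_0_iff)
  then obtain s' where s': "s = of_real s'" by (auto elim: Reals_cases)
  have "z1 = of_real \<rho> * t + of_real s' * cnj t"
    using \<sigma> sum s' unfolding \<sigma>_def by (metis add.commute diff_add_cancel)
  moreover have "z2 = of_real (2 * Re (t\<^sup>2) + \<rho> * s')"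
    unfolding z2 re s' by simp
  ultimately have "(z1, z2, cnj z1) = quadratics_point \<rho> s' t"
    by (simp add: quadratics_point_def)
  then show ?thesis
    using \<rho>2 tn unfolding reflected_pair_set_def by blast
qed

text \<open>
  Either all roots lie on the circle, or one of them is off the circle and pairs with its
  reflection.
\<close>

lemma R3_subset:
  assumes "d \<ge> 2"
  shows "R3 \<subseteq> bounded_orbit_set (A3_map d) \<union> reflected_pair_set"
proof
  fix z assume "z \<in> R3"
  then obtain z1 z2 where z: "z = (z1, z2, cnj z1)" "z2 \<in> \<real>" by (auto simp: R3_def)
  obtain a b c where abc: "a \<noteq> 0" "b \<noteq> 0" "c \<noteq> 0" "z = Phi a b c" by (rule Phi_surj)
  show "z \<in> bounded_orbit_set (A3_map d) \<union> reflected_pair_set"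
  proof (cases "norm a = 1 \<and> norm b = 1 \<and> norm c = 1")
    case True
    then show ?thesis using Phi_mem_bounded_orbit_set_iff[OF assms abc(1-3)] abc by simp
  next
    case False
    then obtain x where "x \<in> {a, b, c}" "norm x \<noteq> 1" by auto
    moreover from this have "x ^ 4 - z1 * x ^ 3 + z2 * x ^ 2 - cnj z1 * x + 1 = 0"
      using Phi_root_iff[OF abc(1-3)] abc(4) z(1) by (metis insert_iff)
    moreover have "x \<noteq> 0" using calculation abc by auto
    ultimately show ?thesis
      using off_circle_root_imp_reflected_pair z by blast
  qed
qed

lemma continuous_quadratics_point:
  "continuous_on A (\<lambda>(\<rho>, s, t). quadratics_point \<rho> s t)"
  unfolding quadratics_point_def case_prod_unfold by (intro continuous_intros)

text \<open>
  Properness of the parametrization of \<^const>\<open>reflected_pair_set\<close>: the middle coordinate bounds \<open>\<rho> * s\<close>, hence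
  \<open>s\<close> as \<open>\<rho> \<ge> 2\<close>, and then the first coordinate bounds \<open>\<rho>\<close>.
\<close>

lemma quadratics_point_parameters_bounded:
  assumes "2 \<le> \<rho>" "norm t = 1" "norm (quadratics_point \<rho> s t) \<le> B"
  shows "\<bar>s\<bar> \<le> B + 2" "\<rho> \<le> 2 * B + 2"
proof -
  let ?z1 = "of_real \<rho> * t + of_real s * cnj t" and ?z2 = "2 * Re (t\<^sup>2) + \<rho> * s"
  have B0: "0 \<le> B" using assms(3) norm_ge_zero order_trans by blast
  have z: "norm ?z1 \<le> B" "norm (complex_of_real ?z2) \<le> B"
    using assms(3) norm_fst_le[of ?z1 "(complex_of_real ?z2, cnj ?z1)"]
      norm_snd_le[of "(complex_of_real ?z2, cnj ?z1)" ?z1]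
      norm_fst_le[of "complex_of_real ?z2" "cnj ?z1"]
    unfolding quadratics_point_def by linarith+
  have "\<bar>?z2\<bar> \<le> B" using z(2) by (metis norm_of_real)
  moreover have "\<bar>Re (t\<^sup>2)\<bar> \<le> 1"
    using abs_Re_le_cmod[of "t\<^sup>2"] assms(2) by (simp add: norm_power)
  ultimately have "\<bar>\<rho> * s\<bar> \<le> B + 2" by linarith
  moreover have "2 * \<bar>s\<bar> \<le> \<rho> * \<bar>s\<bar>" using assms(1) by (intro mult_right_mono) auto
  ultimately have s: "2 * \<bar>s\<bar> \<le> B + 2" using assms(1) by (simp add: abs_mult)
  then show "\<bar>s\<bar> \<le> B + 2" using B0 by linarith
  have "norm (of_real \<rho> * t) \<le> norm ?z1 + norm (of_real s * cnj t)"
    by (metis add_diff_cancel_right' norm_triangle_ineq4)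
  then have "\<rho> \<le> B + \<bar>s\<bar>" using z(1) assms by (simp add: norm_mult)
  then show "\<rho> \<le> 2 * B + 2" using s B0 by linarith
qed

lemma closed_reflected_pair_set: "closed reflected_pair_set"
  unfolding closed_sequential_limits
proof (intro allI impI, elim conjE)
  fix z l assume z: "\<forall>n. z n \<in> reflected_pair_set" and lim: "z \<longlonglongrightarrow> l"
  obtain B where B: "\<And>n. norm (z n) \<le> B"
    using convergent_imp_bounded[OF lim] by (auto simp: bounded_iff)
  let ?C = "(\<lambda>(\<rho>, s, t). quadratics_point \<rho> s t) `
    ({2..2 * B + 2} \<times> {- (B + 2)..B + 2} \<times> sphere 0 1)"
  have "compact ?C"
    by (intro compact_continuous_image continuous_quadratics_point compact_Times
        compact_Icc compact_sphere)
  moreover have "z n \<in> ?C" for n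
  proof -
    obtain \<rho> s t where p: "z n = quadratics_point \<rho> s t" "2 \<le> \<rho>" "norm t = 1"
      using z unfolding reflected_pair_set_def by blast
    then have "(\<rho>, s, t) \<in> {2..2 * B + 2} \<times> {- (B + 2)..B + 2} \<times> sphere 0 1"
      using quadratics_point_parameters_bounded[OF p(2,3)] B[of n] by force
    then show ?thesis using p(1) by force
  qed
  ultimately have "l \<in> ?C"
    using lim compact_imp_closed closed_sequentially by blast
  then show "l \<in> reflected_pair_set" unfolding reflected_pair_set_def by fastforce
qed

section \<open>The boundary\<close>

text \<open>
  The boundary is the intersection of the closures of \<open>K\<close> and of its complement in \<open>R3\<close>. The
  latter lies in the closed set of quartics with a reflected pair, which meets \<open>K\<close> only where
  the pair has become a double root.
\<close>

lemma frontier_bounded_orbit_set: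
  assumes "d \<ge> 2"
  shows "(top_of_set R3) frontier_of (bounded_orbit_set (A3_map d)) =
    {quadratics_point 2 s t | s t. \<bar>s\<bar> \<le> 2 \<and> norm t = 1}"
proof -
  let ?K = "bounded_orbit_set (A3_map d)"
  have K: "closed ?K"
    unfolding bounded_orbit_set_A3_map[OF assms] by (intro compact_imp_closed compact_Phi_torus)
  have fr: "(top_of_set R3) frontier_of ?K = R3 \<inter> closure (R3 \<inter> ?K) \<inter> closure (R3 - ?K)"
    unfolding frontier_of_closures closure_of_subtopology by (auto simp: Int_absorb1 Diff_subset)
  show ?thesis
  proof (intro equalityI subsetI)
    fix z assume "z \<in> (top_of_set R3) frontier_of ?K"
    then have "z \<in> closure (R3 \<inter> ?K)" "z \<in> closure (R3 - ?K)" unfolding fr by auto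
    then have "z \<in> ?K" "z \<in> reflected_pair_set"
      using closure_minimal[OF _ K, of "R3 \<inter> ?K"] R3_subset[OF assms]
        closure_minimal[OF _ closed_reflected_pair_set, of "R3 - ?K"] by auto
    then obtain \<rho> s t where p: "z = quadratics_point \<rho> s t" "2 \<le> \<rho>" "norm t = 1"
      unfolding reflected_pair_set_def by blast
    with \<open>z \<in> ?K\<close> have "\<rho> = 2" "\<bar>s\<bar> \<le> 2"
      using quadratics_point_mem_bounded_orbit_set_iff[OF assms p(3)] by auto
    then show "z \<in> {quadratics_point 2 s t | s t. \<bar>s\<bar> \<le> 2 \<and> norm t = 1}" using p by blast
  next
    fix z assume "z \<in> {quadratics_point 2 s t | s t. \<bar>s\<bar> \<le> 2 \<and> norm t = 1}"
    then obtain s t where p: "z = quadratics_point 2 s t" "\<bar>s\<bar> \<le> 2" "norm t = 1" by blast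
    have "z \<in> R3 \<inter> ?K"
      using quadratics_point_mem_bounded_orbit_set_iff[OF assms p(3)] p quadratics_point_in_R3
      by simp
    \<comment> \<open>Replacing \<open>2\<close> by \<open>2 + \<epsilon>\<close> splits the double root \<open>t\<close> into two real multiples of
      \<open>t\<close> off the circle.\<close>
    moreover have "z \<in> closure (R3 - ?K)"
      unfolding closure_sequential
    proof (intro exI conjI allI)
      fix n
      show "quadratics_point (2 + 1 / real (Suc n)) s t \<in> R3 - ?K"
        using quadratics_point_mem_bounded_orbit_set_iff[OF assms p(3)] quadratics_point_in_R3
        by simp
    next
      have "(\<lambda>n. 2 + 1 / real (Suc n)) \<longlonglongrightarrow> 2 + 0"
        by (intro tendsto_intros lim_1_over_n[THEN LIMSEQ_Suc])
      then show "(\<lambda>n. quadratics_point (2 + 1 / real (Suc n)) s t) \<longlonglongrightarrow> z"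
        unfolding p(1) quadratics_point_def by (intro tendsto_intros) simp_all
    qed
    ultimately show "z \<in> (top_of_set R3) frontier_of ?K"
      unfolding fr using subsetD[OF closure_subset, of z "R3 \<inter> ?K"] by simp
  qed
qed

text \<open>
  The coordinates are \<open>(2 + s) * cos u\<close>, \<open>(2 - s) * sin u\<close> and \<open>2 * cos (2 * u) + 2 * s\<close>:
  for fixed \<open>u\<close> a line in the direction of the ruling, which passes through the astroid at
  \<open>s = 2 * cos (2 * u)\<close>. There \<open>cnj t ^ 3\<close> is the fourth root and \<open>t\<close> is a triple root.
\<close>

lemma R3_coords_quadratics_point:
  "R3_coords (quadratics_point 2 s (cis u)) =
    ruled_surface astroid astroid_ruling u (s - 2 * cos (2 * u))"
proof -
  have c: "cos (2 * u) = 2 * (cos u)\<^sup>2 - 1" "cos (2 * u) = 1 - 2 * (sin u)\<^sup>2"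
    by (rule cos_double_cos, rule cos_double_sin)
  have "2 * cos u + s * cos u = 4 * cos u ^ 3 + (s - 2 * cos (2 * u)) * cos u"
    unfolding c(1) by (simp add: algebra_simps power2_eq_square power3_eq_cube)
  moreover have "2 * sin u - s * sin u = 4 * sin u ^ 3 - (s - 2 * cos (2 * u)) * sin u"
    unfolding c(2) by (simp add: algebra_simps power2_eq_square power3_eq_cube)
  moreover have "Re ((cis u)\<^sup>2) = cos (2 * u)"
    by (simp add: cos_double power2_eq_square)
  ultimately show ?thesis
    by (simp add: R3_coords_def quadratics_point_def ruled_surface_def astroid_def
        astroid_ruling_def algebra_simps)
qed

theorem proposition2p4:
  fixes d :: nat
  assumes "d \<ge> 2"
  shows "tangent_developable astroid astroid_ruling {0..<2 * pi} \<and>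
    K_surface d \<subseteq> {ruled_surface astroid astroid_ruling u v | u v. u \<in> {0..<2 * pi}} \<and>
    K_surface d = {ruled_surface astroid astroid_ruling u v | u v.
      0 \<le> u \<and> u < 2 * pi \<and> - 2 - 2 * cos (2 * u) \<le> v \<and> v \<le> 2 - 2 * cos (2 * u)}"
proof -
  have K: "K_surface d = {ruled_surface astroid astroid_ruling u v | u v.
      0 \<le> u \<and> u < 2 * pi \<and> - 2 - 2 * cos (2 * u) \<le> v \<and> v \<le> 2 - 2 * cos (2 * u)}"
    (is "_ = ?S")
  proof (intro equalityI subsetI)
    fix p assume "p \<in> K_surface d"
    then obtain s t where p: "p = R3_coords (quadratics_point 2 s t)" "\<bar>s\<bar> \<le> 2" "norm t = 1"
      unfolding K_surface_def frontier_bounded_orbit_set[OF assms] by blast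
    obtain u where u: "0 \<le> u" "u < 2 * pi" "t = cis u"
      using complex_unit_circle[of t] sincos_total_2pi[of "Re t" "Im t"] p(3)
      by (metis cis.code complex_surj cmod_power2 one_power2)
    have "p = ruled_surface astroid astroid_ruling u (s - 2 * cos (2 * u))"
      unfolding p(1) u(3) by (rule R3_coords_quadratics_point)
    moreover have "- 2 - 2 * cos (2 * u) \<le> s - 2 * cos (2 * u)"
      "s - 2 * cos (2 * u) \<le> 2 - 2 * cos (2 * u)" using p(2) by auto
    ultimately show "p \<in> ?S" using u by blast
  next
    fix p assume "p \<in> ?S"
    then obtain u v where p: "p = ruled_surface astroid astroid_ruling u v"
      "- 2 - 2 * cos (2 * u) \<le> v" "v \<le> 2 - 2 * cos (2 * u)" by blast
    define s where "s = v + 2 * cos (2 * u)"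
    have "\<bar>s\<bar> \<le> 2" using p by (auto simp: s_def)
    moreover have "p = R3_coords (quadratics_point 2 s (cis u))"
      unfolding R3_coords_quadratics_point p(1) by (simp add: s_def)
    moreover have "norm (cis u) = 1" by simp
    ultimately show "p \<in> K_surface d"
      unfolding K_surface_def frontier_bounded_orbit_set[OF assms] by blast
  qed
  then show ?thesis
    using tangent_developable_astroid by auto
qed

end
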